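(* Let $k, n, m \in \mathbb{N}$ with $k^2 \le n$ and $m = 2n$. Let $f \in F_{k,n}$ with $\|f\|_{k,n} = 1$. Then there is $h \in F_{k,n}$ with $\|h\|_{k,n} = 1$ such that both $$\|f + h\|_{k,n} \le 1 + \frac{1}{k} \quad\text{and}\quad \|f - h\|_{k,n} \le 1 + \frac{1}{k}.$$
   Context: $\mathbb{N} = \{1,2,3,\dots\}$. Let $k, n, m \in \mathbb{N}$ with $k \le n \le m$. Let $e_1^*, \dots, e_m^*$ be the standard unit vectors of $\ell_1^m$ ($\mathbb{R}^m$ with the $\ell_1$-norm), acting on $\ell_\infty^m$ ($\mathbb{R}^m$ with the max-norm) as the coordinate functionals. Put $$A_n = \Big\{\tfrac{1}{n}\sum_{j \in A} e_j^* : A \subseteq \{1,\dots,m\},\ |A| = n\Big\}, \qquad B_k = \Big\{\tfrac{1}{k} e_j^* : j = 1,\dots,m\Big\}, \qquad C_{k,n} = B_k \cup A_n.$$ For $f = (f_j)_{j=1}^m \in \mathbb{R}^m$ define $$\|f\|_{k,n} = \sup_{x \in C_{k,n}} |f(x)|,$$ where $f(x) = \frac1n \sum_{j \in A} f_j$ if $x = \frac1n\sum_{j\in A} e_j^* \in A_n$, and $f(x) = \frac1k f_j$ if $x = \frac1k e_j^* \in B_k$. This is a norm on $\mathbb{R}^m$, and $F_{k,n}$ denotes $\mathbb{R}^m$ equipped with the norm $\|\cdot\|_{k,n}$. *)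

theory Defs
  imports "HOL-Analysis.Analysis"
begin

text \<open>
  The index set \<open>{1,\<dots>,m}\<close> is a finite type \<open>'m\<close> with \<open>CARD('m) = m\<close>, so \<open>\<real>\<^sup>m\<close> is \<open>real ^ 'm\<close>
  and the unit vector \<open>e\<^sub>j\<^sup>*\<close> is \<open>axis j 1\<close>. An element \<open>x\<close> of \<open>\<ell>\<^sub>1\<^sup>m\<close> is paired with \<open>f\<close> by
  \<open>f(x) = x \<bullet> f\<close>; the lemmas \<open>inner_A_set\<close> and \<open>inner_B_set\<close> below evaluate the pairing.
\<close>

definition A_set :: "nat \<Rightarrow> (real ^ 'm) set" where
  "A_set n = {(1 / real n) *\<^sub>R (\<Sum>j\<in>A. axis j 1) | A. card A = n}"

definition B_set :: "nat \<Rightarrow> (real ^ 'm) set" where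
  "B_set k = {(1 / real k) *\<^sub>R axis j 1 | j. True}"

definition C_set :: "nat \<Rightarrow> nat \<Rightarrow> (real ^ 'm) set" where
  "C_set k n = B_set k \<union> A_set n"

definition norm_F :: "nat \<Rightarrow> nat \<Rightarrow> real ^ 'm \<Rightarrow> real" where
  "norm_F k n f = (SUP x\<in>C_set k n. \<bar>x \<bullet> f\<bar>)"

lemma inner_A_set:
  fixes f :: "real ^ 'm"
  shows "((1 / real n) *\<^sub>R (\<Sum>j\<in>A. axis j 1)) \<bullet> f = (1 / real n) * (\<Sum>j\<in>A. f $ j)"
  by (simp add: inner_sum_left inner_axis')

lemma inner_B_set:
  fixes f :: "real ^ 'm"
  shows "((1 / real k) *\<^sub>R axis j 1) \<bullet> f = (1 / real k) * f $ j"
  by (simp add: inner_axis')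

text \<open>\<open>C_set k n\<close> is finite and nonempty, so the supremum is a maximum; for \<open>k \<ge> 1\<close>
  \<open>norm_F k n\<close> is a norm.\<close>

lemma finite_C_set: "finite (C_set k n :: (real ^ 'm) set)"
proof -
  have "A_set n \<subseteq> range (\<lambda>A :: 'm set. (1 / real n) *\<^sub>R (\<Sum>j\<in>A. axis j (1 :: real)))"
    by (auto simp: A_set_def)
  then have "finite (A_set n :: (real ^ 'm) set)"
    by (rule finite_subset) simp
  moreover have "B_set k = range (\<lambda>j :: 'm. (1 / real k) *\<^sub>R axis j (1 :: real))"
    by (auto simp: B_set_def)
  then have "finite (B_set k :: (real ^ 'm) set)"
    by simp
  ultimately show ?thesis
    by (simp add: C_set_def)
qed

lemma C_set_nonempty: "C_set k n \<noteq> {}"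
  by (auto simp: C_set_def B_set_def)

lemma norm_F_upper:
  fixes f :: "real ^ 'm"
  shows "x \<in> C_set k n \<Longrightarrow> \<bar>x \<bullet> f\<bar> \<le> norm_F k n f"
  unfolding norm_F_def by (intro cSUP_upper bdd_above_finite finite_imageI finite_C_set)

lemma norm_F_nonneg: "0 \<le> norm_F k n f"
  using C_set_nonempty norm_F_upper by (metis abs_ge_zero ex_in_conv order_trans)

lemma norm_F_eq_0_iff:
  fixes f :: "real ^ 'm"
  assumes "1 \<le> k"
  shows "norm_F k n f = 0 \<longleftrightarrow> f = 0"
proof
  assume *: "norm_F k n f = 0"
  have "f $ j = 0" for j
  proof -
    have "(1 / real k) *\<^sub>R axis j 1 \<in> C_set k n"
      by (auto simp: C_set_def B_set_def)
    from norm_F_upper[OF this, of f] * assms show ?thesis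
      unfolding inner_B_set by (simp add: divide_le_0_iff)
  qed
  then show "f = 0"
    by (simp add: vec_eq_iff)
next
  assume "f = 0"
  then show "norm_F k n f = 0"
    by (simp add: norm_F_def C_set_nonempty)
qed

lemma norm_F_triangle: "norm_F k n (f + g) \<le> norm_F k n f + norm_F k n g"
  unfolding norm_F_def[of k n "f + g"]
  by (rule cSUP_least[OF C_set_nonempty])
    (use norm_F_upper in \<open>fastforce simp: inner_add_right intro: order_trans[OF abs_triangle_ineq] add_mono\<close>)

lemma norm_F_scaleR:
  "norm_F k n (c *\<^sub>R f) = \<bar>c\<bar> * norm_F k n f"
proof (rule antisym)
  have le: "norm_F k n (a *\<^sub>R g) \<le> \<bar>a\<bar> * norm_F k n g" for a and g :: "real ^ 'a"
    unfolding norm_F_def[of k n "a *\<^sub>R g"]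
    by (rule cSUP_least[OF C_set_nonempty])
      (simp add: abs_mult mult_left_mono norm_F_upper)
  show "norm_F k n (c *\<^sub>R f) \<le> \<bar>c\<bar> * norm_F k n f"
    by (rule le)
  show "\<bar>c\<bar> * norm_F k n f \<le> norm_F k n (c *\<^sub>R f)"
  proof (cases "c = 0")
    case False
    then show ?thesis
      using le[of "inverse c" "c *\<^sub>R f"] by (simp add: field_simps)
  qed (simp add: norm_F_nonneg)
qed

end

theory Submission
  imports Defs
begin

text \<open>
  The norm tests a vector both by its coordinates, scaled by \<open>1 / k\<close>, and by its averages over
  \<open>n\<close>-element sets. A vector of norm at most \<open>1\<close> on \<open>2 n\<close> coordinates has a coordinate \<open>j\<close> with
  \<open>\<bar>f $ j\<bar> \<le> 1\<close> (lemma \<open>norm_F_le_1_small_coordinate\<close>): otherwise \<open>n\<close> coordinates of the same sign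
  exceed \<open>1\<close> in modulus, and so does their average. The direction \<open>h\<close> is the spike of height \<open>k\<close> at
  this \<open>j\<close>. It has norm \<open>1\<close> because of its coordinate \<open>j\<close>. Adding or subtracting it takes coordinate
  \<open>j\<close> to at most \<open>k + 1\<close>, which costs \<open>1 / k\<close> after scaling, and it moves an \<open>n\<close>-average by at most
  \<open>k / n\<close>, which is at most \<open>1 / k\<close> because \<open>k\<^sup>2 \<le> n\<close>
  (lemma \<open>norm_F_add_spike_le\<close>).
\<close>

lemma norm_F_le_iff:
  fixes f :: "real ^ 'm"
  assumes "1 \<le> k" and "1 \<le> n"
  shows "norm_F k n f \<le> c \<longleftrightarrow>
    (\<forall>j. \<bar>f $ j\<bar> \<le> real k * c) \<and> (\<forall>A. card A = n \<longrightarrow> \<bar>\<Sum>j\<in>A. f $ j\<bar> \<le> real n * c)"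
proof -
  have "norm_F k n f \<le> c \<longleftrightarrow> (\<forall>x\<in>C_set k n. \<bar>x \<bullet> f\<bar> \<le> c)"
    unfolding norm_F_def
    by (intro cSUP_le_iff bdd_above_finite finite_imageI finite_C_set C_set_nonempty)
  also have "\<dots> \<longleftrightarrow> (\<forall>j. \<bar>(1 / real k) * f $ j\<bar> \<le> c) \<and>
      (\<forall>A. card A = n \<longrightarrow> \<bar>(1 / real n) * (\<Sum>j\<in>A. f $ j)\<bar> \<le> c)"
    unfolding C_set_def B_set_def A_set_def inner_A_set[symmetric] inner_B_set[symmetric]
    by blast
  also have "\<dots> \<longleftrightarrow>
    (\<forall>j. \<bar>f $ j\<bar> \<le> real k * c) \<and> (\<forall>A. card A = n \<longrightarrow> \<bar>\<Sum>j\<in>A. f $ j\<bar> \<le> real n * c)"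
    using assms by (simp add: abs_mult field_simps)
  finally show ?thesis .
qed

lemma sum_axis:
  fixes A :: "'m::finite set"
  shows "(\<Sum>i\<in>A. axis j s $ i) = (if j \<in> A then s else 0 :: real)"
  by (simp add: axis_def)

lemma norm_F_axis:
  fixes j :: "'m::finite"
  assumes "1 \<le> k" and "k \<le> n"
  shows "norm_F k n (axis j s) = \<bar>s\<bar> / real k"
proof (rule antisym)
  have "\<bar>s\<bar> * real k \<le> \<bar>s\<bar> * real n"
    using assms by (intro mult_left_mono) auto
  then show "norm_F k n (axis j s) \<le> \<bar>s\<bar> / real k"
    using assms by (subst norm_F_le_iff) (auto simp: sum_axis axis_def field_simps)
  have "(1 / real k) *\<^sub>R axis j 1 \<in> C_set k n"
    by (auto simp: C_set_def B_set_def)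
  from norm_F_upper[OF this, of "axis j s"] assms
  show "\<bar>s\<bar> / real k \<le> norm_F k n (axis j s)"
    unfolding inner_B_set by (simp add: axis_def abs_mult)
qed

text \<open>
  Were all coordinates larger than \<open>1\<close> in modulus, the positive ones or the nonpositive ones would
  number at least \<open>n\<close>, by pigeonhole; there is no cancellation in an average of \<open>n\<close> of them.
\<close>

lemma norm_F_le_1_small_coordinate:
  fixes f :: "real ^ 'm"
  assumes "1 \<le> k" and "1 \<le> n" and card: "2 * n \<le> CARD('m) + 1"
    and norm: "norm_F k n f \<le> 1"
  obtains j where "\<bar>f $ j\<bar> \<le> 1"
proof (rule ccontr)
  assume "\<not> thesis"
  with that have large: "1 < \<bar>f $ j\<bar>" for j
    by (meson not_less)
  define P where "P = {j. 0 < f $ j}"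
  have "card P + card (- P) = CARD('m)"
    by (metis Compl_disjoint Compl_partition card_Un_disjoint finite)
  with card have "n \<le> card P \<or> n \<le> card (- P)"
    by linarith
  then obtain A where A: "card A = n" "A \<subseteq> P \<or> A \<subseteq> - P"
    by (meson obtain_subset_with_card_n)
  have "\<bar>\<Sum>j\<in>A. f $ j\<bar> = (\<Sum>j\<in>A. \<bar>f $ j\<bar>)"
    using A(2)
  proof
    assume "A \<subseteq> P"
    then have "(\<Sum>j\<in>A. f $ j) = (\<Sum>j\<in>A. \<bar>f $ j\<bar>)"
      by (intro sum.cong) (auto simp: P_def)
    then show ?thesis by (simp add: sum_nonneg)
  next
    assume "A \<subseteq> - P"
    then have "(\<Sum>j\<in>A. - f $ j) = (\<Sum>j\<in>A. \<bar>f $ j\<bar>)"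
      by (intro sum.cong) (auto simp: P_def)
    then show ?thesis
      by (metis abs_minus_cancel abs_sum_abs sum_negf)
  qed
  moreover have "(\<Sum>j\<in>A. 1) < (\<Sum>j\<in>A. \<bar>f $ j\<bar>)"
    using A(1) \<open>1 \<le> n\<close> large by (intro sum_strict_mono) auto
  ultimately have "real n < \<bar>\<Sum>j\<in>A. f $ j\<bar>"
    using A(1) by simp
  moreover have "\<bar>\<Sum>j\<in>A. f $ j\<bar> \<le> real n"
    using norm A(1) assms(1,2) by (simp add: norm_F_le_iff)
  ultimately show False by simp
qed

text \<open>
  The hypothesis \<open>k\<^sup>2 \<le> n\<close> enters through \<open>n + k \<le> n (1 + 1 / k)\<close>; the bound at coordinate \<open>j\<close> is
  \<open>1 + k = k (1 + 1 / k)\<close>. The sign of \<open>s\<close> is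
  free, so that the same bound serves for adding and for subtracting a spike.
\<close>

lemma norm_F_add_spike_le:
  fixes f :: "real ^ 'm"
  assumes "1 \<le> k" and "k ^ 2 \<le> n"
    and norm: "norm_F k n f \<le> 1" and small: "\<bar>f $ j\<bar> \<le> 1" and s: "\<bar>s\<bar> \<le> real k"
  shows "norm_F k n (f + axis j s) \<le> 1 + 1 / real k"
proof -
  have "1 \<le> n"
    using assms(1,2) by (metis le_trans one_le_power)
  have coord: "\<bar>f $ i\<bar> \<le> real k" for i
    using norm assms(1) \<open>1 \<le> n\<close> by (simp add: norm_F_le_iff)
  have avg: "\<bar>\<Sum>i\<in>A. f $ i\<bar> \<le> real n" if "card A = n" for A
    using norm assms(1) \<open>1 \<le> n\<close> that by (simp add: norm_F_le_iff)
  have "real k * real k \<le> real n"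
    using assms(2) by (metis of_nat_le_iff of_nat_mult power2_eq_square)
  then have k_le: "real k \<le> real n / real k"
    using assms(1) by (simp add: field_simps)
  have "\<bar>(f + axis j s) $ i\<bar> \<le> real k * (1 + 1 / real k)" for i
  proof -
    have "\<bar>(f + axis j s) $ i\<bar> \<le> real k + 1"
      using coord[of i] small s by (auto simp: axis_def)
    then show ?thesis
      using assms(1) by (simp add: distrib_left)
  qed
  moreover have "\<bar>\<Sum>i\<in>A. (f + axis j s) $ i\<bar> \<le> real n * (1 + 1 / real k)" if "card A = n" for A
  proof -
    have "\<bar>\<Sum>i\<in>A. (f + axis j s) $ i\<bar> \<le> real n + real k"
      using avg[OF that] s by (auto simp: sum.distrib sum_axis)
    also have "\<dots> \<le> real n * (1 + 1 / real k)"
      using k_le by (simp add: distrib_left)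
    finally show ?thesis .
  qed
  ultimately show ?thesis
    using assms(1) \<open>1 \<le> n\<close> by (simp only: norm_F_le_iff) blast
qed

theorem lemma2p2:
  fixes k n m :: nat and f :: "real ^ 'm"
  assumes "1 \<le> k" and "1 \<le> n" and "CARD('m) = m"
    and "k ^ 2 \<le> n" and "m = 2 * n"
    and "norm_F k n f = 1"
  shows "\<exists>h :: real ^ 'm. norm_F k n h = 1 \<and>
    norm_F k n (f + h) \<le> 1 + 1 / real k \<and> norm_F k n (f - h) \<le> 1 + 1 / real k"
proof -
  obtain j where j: "\<bar>f $ j\<bar> \<le> 1"
    using norm_F_le_1_small_coordinate[of k n f] assms by auto
  have "k \<le> n"
    using assms(1,4) by (simp add: power2_nat_le_imp_le)
  let ?h = "axis j (real k)"
  have minus: "f - ?h = f + axis j (- real k)"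
    by (simp add: vec_eq_iff axis_def)
  have "norm_F k n ?h = 1"
    using assms(1) \<open>k \<le> n\<close> by (simp add: norm_F_axis)
  moreover have "norm_F k n (f + ?h) \<le> 1 + 1 / real k"
    using assms j by (intro norm_F_add_spike_le) auto
  moreover have "norm_F k n (f - ?h) \<le> 1 + 1 / real k"
    unfolding minus using assms j by (intro norm_F_add_spike_le) auto
  ultimately show ?thesis by blast
qed

end
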